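(* Let $(\mathbf w^1,d^1),(\mathbf w^2,d^2)\in\mathbb{W}^N\times\mathbb{D}$ be two scenarios that are similar with tolerances $\epsilon_w=\frac1N\epsilon_w^*$ and $\epsilon_d=\epsilon_d^*$, i.e. $\frac1N\|\mathbf w^1-\mathbf w^2\|_2^2\le\frac1N\epsilon_w^*$ and $\|d^1-d^2\|_2^2\le\epsilon_d^*$ with $\epsilon_w^*,\epsilon_d^*\ge0$, and let $\varsigma_w>0$ be such that $\|(\mathbf w^i,d^i)\|_2\le\varsigma_w$ for $i=1,2$. Let $(\mathbf q^*,r^*,\gamma^* )$ be a solution of the robust optimal control problem $\mathcal{P}_N(\mathbb{H})$ obtained for $(\mathbf w^1,d^1)$, i.e. with $\mathbb{H}=\{(\mathbf w^1,d^1)\}$, and let $\mathbf z^1=\mathbf z(\mathbf q^*,r^*,\mathbf w^1,d^1)$, $\mathbf z^2=\mathbf z(\mathbf q^*,r^*,\mathbf w^2,d^2)$. Let $\varsigma_z>0$ be the bound associated with $\varsigma_w$ by BIBO stability of the trajectories for the parameters $(\mathbf q^*,r^* )$ (see context). Then the constraint violation for $(\mathbf w^2,d^2)$ is bounded, and for each $k=0,\dots,N-1$ $$\|g_k(z_k^1,w_k^1,d^1)-g_k(z_k^2,w_k^2,d^2)\|_2^2\le L^2\big(\epsilon_w^*+\epsilon_d^*+4\varsigma_z^2\big),$$ where $z_k^i=(x_k^i,u_k^i)$ is the trajectory $\mathbf z^i$ at time $k$, $i=1,2$, and $L$ is a local Lipschitz constant of $g_k$ for the given $k$, i.e. a Lipschitz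 constant (in the Euclidean norm) of $g_k$ on a set containing the points $(z_k^1,w_k^1,d^1)$ and $(z_k^2,w_k^2,d^2)$.
   Context: Setting. $N\ge 1$ is an integer horizon; $\mathbb{W}\subset\mathbb{R}^{n_w}$, $\mathbb{D}\subset\mathbb{R}^{n_d}$ are nonempty compact sets. The system is $x_{k+1}=f_k(x_k,u_k,w_k,d)$, $x_0=\hat x$ (given), with $x_k\in\mathbb{R}^{n_x}$, $u_k\in\mathbb{R}^{n_u}$, $w_k\in\mathbb{W}$, $d\in\mathbb{D}$, $f_k$ continuously differentiable, and control given by a causal feedback policy $u_k=\pi_k(x_0,\dots,x_k;q_0,\dots,q_k,r)$ with parameters $\mathbf q=(q_0,\dots,q_{N-1})\in\mathbb{R}^{n_q}$, $r\in\mathbb{R}^{n_r}$. Write $\mathbf x=(x_0,\dots,x_N)$, $\mathbf u=(u_0,\dots,u_{N-1})$, $\mathbf w=(w_0,\dots,w_{N-1})\in\mathbb{W}^N$. $\mathbf z(\mathbf q,r,\mathbf w,d)$ denotes the unique trajectory $(\mathbf x,\mathbf u)$ satisfying these relations for $k=0,\dots,N-1$; it is assumed bounded over the finite horizon. A scenario is an element $(\mathbf w,d)\in\mathbb{W}^N\times\mathbb{D}$. Cost: $J_N(\mathbf x,\mathbf u,\mathbf w,d)=J_f(x_N,\mathbf w,d)+\sum_{k=0}^{N-1}\ell_k(x_k,u_k,w_k,d)$ with $J_f,\ell_k$ continuously differentiable. Constraints: $g_k(x_k,u_k,w_k,d)\le0$ (componentwise), $g_k$ continuously differentiable with values in $\mathbb{R}^{n_g}$,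 $k=0,\dots,N-1$. For $\mathbb{H}\subseteq\mathbb{W}^N\times\mathbb{D}$, $\mathcal{P}_N(\mathbb{H})$ is the problem of minimizing $\gamma$ over $(\mathbf q,r,\gamma)$ subject to, for all $(\mathbf w,d)\in\mathbb{H}$ with $(\mathbf x,\mathbf u)=\mathbf z(\mathbf q,r,\mathbf w,d)$: $g_k(x_k,u_k,w_k,d)\le0$ for $k=0,\dots,N-1$, and $J_N(\mathbf x,\mathbf u,\mathbf w,d)\le\gamma$. BIBO stability assumption: for the chosen parameters $(\mathbf q^*,r^* )$, for every $\varsigma_w>0$ there exists $\varsigma_z>0$ such that every scenario with $\|(\mathbf w,d)\|_2\le\varsigma_w$ satisfies $\|\mathbf z(\mathbf q^*,r^*,\mathbf w,d)\|_2\le\varsigma_z$. *)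

theory Defs
  imports "HOL-Analysis.Analysis"
begin

text \<open>
  The horizon \<open>N\<close> is \<open>CARD('N)\<close> for a linearly ordered finite index type \<open>'N\<close>, so that
  disturbance sequences form the Euclidean space \<open>(real^'nw)^'N\<close>, with its Euclidean norm and
  its notion of derivative. Times are natural numbers; \<open>at_time w k\<close> is \<open>w\<^sub>k\<close>, the entry of \<open>w\<close>
  at the \<open>k\<close>-th smallest index, and is meaningful only for \<open>k < CARD('N)\<close>.
\<close>

type_synonym ('nw, 'N) wseq = "((real, 'nw) vec, 'N) vec"

definition at_time :: "'a^'N::{finite,linorder} \<Rightarrow> nat \<Rightarrow> 'a" where
  "at_time w k = w $ (sorted_list_of_set (UNIV :: 'N set) ! k)"

definition continuously_differentiable ::
    "('a::real_normed_vector \<Rightarrow> 'b::real_normed_vector) \<Rightarrow> bool" where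
  "continuously_differentiable F \<longleftrightarrow>
     (\<exists>F' :: 'a \<Rightarrow> 'a \<Rightarrow>\<^sub>L 'b.
        (\<forall>p. (F has_derivative blinfun_apply (F' p)) (at p)) \<and> continuous_on UNIV F')"

text \<open>
  The sub-vectors \<open>q\<^sub>0, \<dots>, q\<^sub>N\<^sub>-\<^sub>1\<close> of \<open>q\<close> may have different dimensions: \<open>blk j\<close> is the index
  of the sub-vector to which coordinate \<open>j\<close> belongs, and \<open>q\<^sub>k\<close> is embedded into \<open>real^'nq\<close> by
  zeros in the coordinates of the other sub-vectors.
\<close>

definition subvector :: "('nq \<Rightarrow> nat) \<Rightarrow> real^'nq::finite \<Rightarrow> nat \<Rightarrow> real^'nq" where
  "subvector blk q k = (\<chi> j. if blk j = k then q $ j else 0)"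

text \<open>
  A causal policy at time \<open>k\<close> is a function of the lists \<open>[x\<^sub>0, \<dots>, x\<^sub>k]\<close> and \<open>[q\<^sub>0, \<dots>, q\<^sub>k]\<close>
  and of \<open>r\<close>.
\<close>

type_synonym ('nx, 'nu, 'nq, 'nr) policy =
  "nat \<Rightarrow> (real^'nx) list \<Rightarrow> (real^'nq) list \<Rightarrow> real^'nr \<Rightarrow> real^'nu"

type_synonym ('nx, 'nu, 'nw, 'nd, 'b) stage_fun =
  "nat \<Rightarrow> (real^'nx) \<times> (real^'nu) \<times> (real^'nw) \<times> (real^'nd) \<Rightarrow> 'b"

definition control ::
    "('nx::finite, 'nu::finite, 'nq::finite, 'nr::finite) policy \<Rightarrow> ('nq \<Rightarrow> nat) \<Rightarrow>
     real^'nq \<Rightarrow> real^'nr \<Rightarrow> nat \<Rightarrow> (real^'nx) list \<Rightarrow> real^'nu" where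
  "control \<pi> blk q r k xs = \<pi> k xs (map (subvector blk q) [0..<Suc k]) r"

primrec state_history ::
    "('nx::finite, 'nu::finite, 'nw::finite, 'nd::finite, real^'nx) stage_fun \<Rightarrow>
     ('nx, 'nu, 'nq::finite, 'nr::finite) policy \<Rightarrow> ('nq \<Rightarrow> nat) \<Rightarrow> real^'nx \<Rightarrow>
     real^'nq \<Rightarrow> real^'nr \<Rightarrow> ('nw, 'N::{finite,linorder}) wseq \<Rightarrow> real^'nd \<Rightarrow>
     nat \<Rightarrow> (real^'nx) list" where
  "state_history f \<pi> blk xhat q r w d 0 = [xhat]"
| "state_history f \<pi> blk xhat q r w d (Suc k) =
     (let xs = state_history f \<pi> blk xhat q r w d k
      in xs @ [f k (last xs, control \<pi> blk q r k xs, at_time w k, d)])"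

text \<open>
  The trajectory \<open>z(q, r, w, d) = (x, u)\<close>. Only \<open>x\<^sub>0, \<dots>, x\<^sub>N\<close> and \<open>u\<^sub>0, \<dots>, u\<^sub>N\<^sub>-\<^sub>1\<close> are
  meaningful; the defining relations and uniqueness are proved in \<open>is_trajectory_iff\<close>.
\<close>

definition trajectory ::
    "('nx::finite, 'nu::finite, 'nw::finite, 'nd::finite, real^'nx) stage_fun \<Rightarrow>
     ('nx, 'nu, 'nq::finite, 'nr::finite) policy \<Rightarrow> ('nq \<Rightarrow> nat) \<Rightarrow> real^'nx \<Rightarrow>
     real^'nq \<Rightarrow> real^'nr \<Rightarrow> ('nw, 'N::{finite,linorder}) wseq \<Rightarrow> real^'nd \<Rightarrow>
     (nat \<Rightarrow> real^'nx) \<times> (nat \<Rightarrow> real^'nu)" where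
  "trajectory f \<pi> blk xhat q r w d =
     (\<lambda>k. last (state_history f \<pi> blk xhat q r w d k),
      \<lambda>k. control \<pi> blk q r k (state_history f \<pi> blk xhat q r w d k))"

definition is_trajectory ::
    "('nx::finite, 'nu::finite, 'nw::finite, 'nd::finite, real^'nx) stage_fun \<Rightarrow>
     ('nx, 'nu, 'nq::finite, 'nr::finite) policy \<Rightarrow> ('nq \<Rightarrow> nat) \<Rightarrow> real^'nx \<Rightarrow>
     real^'nq \<Rightarrow> real^'nr \<Rightarrow> ('nw, 'N::{finite,linorder}) wseq \<Rightarrow> real^'nd \<Rightarrow>
     (nat \<Rightarrow> real^'nx) \<Rightarrow> (nat \<Rightarrow> real^'nu) \<Rightarrow> bool" where
  "is_trajectory f \<pi> blk xhat q r w d x u \<longleftrightarrow>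
     x 0 = xhat \<and>
     (\<forall>k<CARD('N).
        u k = \<pi> k (map x [0..<Suc k]) (map (subvector blk q) [0..<Suc k]) r \<and>
        x (Suc k) = f k (x k, u k, at_time w k, d))"

lemma state_history_eq_map:
  "state_history f \<pi> blk xhat q r w d k =
     map (fst (trajectory f \<pi> blk xhat q r w d)) [0..<Suc k]"
proof (induction k)
  case 0
  show ?case by (simp add: trajectory_def)
next
  case (Suc k)
  let ?x = "fst (trajectory f \<pi> blk xhat q r w d)"
  have "state_history f \<pi> blk xhat q r w d (Suc k) =
      state_history f \<pi> blk xhat q r w d k @ [?x (Suc k)]"
    by (simp add: trajectory_def Let_def)
  then show ?case by (simp only: Suc.IH upt_Suc_append[OF le0] map_append list.map)
qed

lemma is_trajectory_trajectory:
  "is_trajectory f \<pi> blk xhat q r w d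
     (fst (trajectory f \<pi> blk xhat q r w d)) (snd (trajectory f \<pi> blk xhat q r w d))"
proof -
  have "snd (trajectory f \<pi> blk xhat q r w d) k =
      \<pi> k (map (fst (trajectory f \<pi> blk xhat q r w d)) [0..<Suc k])
          (map (subvector blk q) [0..<Suc k]) r" for k
    unfolding state_history_eq_map[symmetric] by (simp add: trajectory_def control_def)
  moreover have "fst (trajectory f \<pi> blk xhat q r w d) (Suc k) =
      f k (fst (trajectory f \<pi> blk xhat q r w d) k,
           snd (trajectory f \<pi> blk xhat q r w d) k, at_time w k, d)" for k
    by (simp add: trajectory_def Let_def)
  ultimately show ?thesis
    by (simp add: is_trajectory_def trajectory_def)
qed

lemma is_trajectory_iff:
  fixes w :: "('nw::finite, 'N::{finite,linorder}) wseq"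
  shows "is_trajectory f \<pi> blk xhat q r w d x u \<longleftrightarrow>
     (\<forall>k\<le>CARD('N). x k = fst (trajectory f \<pi> blk xhat q r w d) k) \<and>
     (\<forall>k<CARD('N). u k = snd (trajectory f \<pi> blk xhat q r w d) k)"
    (is "?L \<longleftrightarrow> ?R")
proof
  let ?x = "fst (trajectory f \<pi> blk xhat q r w d)"
  let ?u = "snd (trajectory f \<pi> blk xhat q r w d)"
  have T: "is_trajectory f \<pi> blk xhat q r w d ?x ?u"
    by (rule is_trajectory_trajectory)
  {
    assume L: ?L
    have step: "u k = ?u k" if "k < CARD('N)" "\<forall>i\<le>k. x i = ?x i" for k
    proof -
      have "map x [0..<Suc k] = map ?x [0..<Suc k]"
        using that(2) by (intro map_cong) auto
      then show ?thesis
        using L T that(1) unfolding is_trajectory_def by metis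
    qed
    have X: "\<forall>i\<le>k. x i = ?x i" if "k \<le> CARD('N)" for k
      using that
    proof (induction k)
      case 0
      then show ?case using L T by (simp add: is_trajectory_def)
    next
      case (Suc k)
      then have k: "k < CARD('N)" and IH: "\<forall>i\<le>k. x i = ?x i" by auto
      have "x (Suc k) = ?x (Suc k)"
        using L T k step[OF k IH] IH unfolding is_trajectory_def by (metis order_refl)
      with IH show ?case using le_Suc_eq by auto
    qed
    then show ?R using step by (meson less_imp_le order_refl)
  }
  {
    assume R: ?R
    have "map x [0..<Suc k] = map ?x [0..<Suc k]" if "k < CARD('N)" for k
      using R that by (intro map_cong) auto
    then show ?L
      using R T unfolding is_trajectory_def
      by (metis Suc_leI less_imp_le zero_le)
  }
qed

definition traj_norm ::
    "nat \<Rightarrow> (nat \<Rightarrow> real^'nx::finite) \<times> (nat \<Rightarrow> real^'nu::finite) \<Rightarrow> real" where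
  "traj_norm N z = sqrt ((\<Sum>k\<le>N. (norm (fst z k))\<^sup>2) + (\<Sum>k<N. (norm (snd z k))\<^sup>2))"

definition scenarios ::
    "(real^'nw::finite) set \<Rightarrow> (real^'nd::finite) set \<Rightarrow>
     (('nw, 'N::finite) wseq \<times> (real^'nd)) set" where
  "scenarios W D = {w. \<forall>i. w $ i \<in> W} \<times> D"

definition similar ::
    "real \<Rightarrow> real \<Rightarrow> ('nw::finite, 'N::finite) wseq \<times> (real^'nd::finite) \<Rightarrow>
     ('nw, 'N) wseq \<times> (real^'nd) \<Rightarrow> bool" where
  "similar \<epsilon>\<^sub>w \<epsilon>\<^sub>d s t \<longleftrightarrow>
     1 / real CARD('N) * (norm (fst s - fst t))\<^sup>2 \<le> \<epsilon>\<^sub>w \<and> (norm (snd s - snd t))\<^sup>2 \<le> \<epsilon>\<^sub>d"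

definition total_cost ::
    "((real^'nx::finite) \<times> ('nw::finite, 'N::{finite,linorder}) wseq \<times> (real^'nd::finite)
        \<Rightarrow> real) \<Rightarrow>
     ('nx, 'nu::finite, 'nw, 'nd, real) stage_fun \<Rightarrow>
     (nat \<Rightarrow> real^'nx) \<Rightarrow> (nat \<Rightarrow> real^'nu) \<Rightarrow> ('nw, 'N) wseq \<Rightarrow> real^'nd \<Rightarrow> real" where
  "total_cost Jf ell x u w d =
     Jf (x CARD('N), w, d) + (\<Sum>k<CARD('N). ell k (x k, u k, at_time w k, d))"

text \<open>The order \<open>\<le>\<close> on vectors is componentwise.\<close>

definition feasible ::
    "('nx::finite, 'nu::finite, 'nw::finite, 'nd::finite, real^'nx) stage_fun \<Rightarrow>
     ('nx, 'nu, 'nq::finite, 'nr::finite) policy \<Rightarrow> ('nq \<Rightarrow> nat) \<Rightarrow> real^'nx \<Rightarrow>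
     ((real^'nx) \<times> ('nw, 'N::{finite,linorder}) wseq \<times> (real^'nd) \<Rightarrow> real) \<Rightarrow>
     ('nx, 'nu, 'nw, 'nd, real) stage_fun \<Rightarrow>
     ('nx, 'nu, 'nw, 'nd, real^'ng::finite) stage_fun \<Rightarrow>
     (('nw, 'N) wseq \<times> (real^'nd)) set \<Rightarrow> real^'nq \<Rightarrow> real^'nr \<Rightarrow> real \<Rightarrow> bool" where
  "feasible f \<pi> blk xhat Jf ell g H q r \<gamma> \<longleftrightarrow>
     (\<forall>(w, d)\<in>H. \<forall>x u. (x, u) = trajectory f \<pi> blk xhat q r w d \<longrightarrow>
        (\<forall>k<CARD('N). g k (x k, u k, at_time w k, d) \<le> 0) \<and>
        total_cost Jf ell x u w d \<le> \<gamma>)"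

definition robust_ocp_solution ::
    "('nx::finite, 'nu::finite, 'nw::finite, 'nd::finite, real^'nx) stage_fun \<Rightarrow>
     ('nx, 'nu, 'nq::finite, 'nr::finite) policy \<Rightarrow> ('nq \<Rightarrow> nat) \<Rightarrow> real^'nx \<Rightarrow>
     ((real^'nx) \<times> ('nw, 'N::{finite,linorder}) wseq \<times> (real^'nd) \<Rightarrow> real) \<Rightarrow>
     ('nx, 'nu, 'nw, 'nd, real) stage_fun \<Rightarrow>
     ('nx, 'nu, 'nw, 'nd, real^'ng::finite) stage_fun \<Rightarrow>
     (('nw, 'N) wseq \<times> (real^'nd)) set \<Rightarrow> real^'nq \<Rightarrow> real^'nr \<Rightarrow> real \<Rightarrow> bool" where
  "robust_ocp_solution f \<pi> blk xhat Jf ell g H q r \<gamma> \<longleftrightarrow>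
     feasible f \<pi> blk xhat Jf ell g H q r \<gamma> \<and>
     (\<forall>q' r' \<gamma>'. feasible f \<pi> blk xhat Jf ell g H q' r' \<gamma>' \<longrightarrow> \<gamma> \<le> \<gamma>')"

text \<open>\<open>\<sigma>\<^sub>z\<close> is a bound associated with \<open>\<sigma>\<^sub>w\<close> by BIBO stability for the parameters \<open>(q, r)\<close>.\<close>

definition bibo_bound ::
    "('nx::finite, 'nu::finite, 'nw::finite, 'nd::finite, real^'nx) stage_fun \<Rightarrow>
     ('nx, 'nu, 'nq::finite, 'nr::finite) policy \<Rightarrow> ('nq \<Rightarrow> nat) \<Rightarrow> real^'nx \<Rightarrow>
     (('nw, 'N::{finite,linorder}) wseq \<times> (real^'nd)) set \<Rightarrow> real^'nq \<Rightarrow> real^'nr \<Rightarrow>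
     real \<Rightarrow> real \<Rightarrow> bool" where
  "bibo_bound f \<pi> blk xhat S q r \<sigma>\<^sub>w \<sigma>\<^sub>z \<longleftrightarrow>
     (\<forall>(w, d)\<in>S. norm (w, d) \<le> \<sigma>\<^sub>w \<longrightarrow>
        traj_norm CARD('N) (trajectory f \<pi> blk xhat q r w d) \<le> \<sigma>\<^sub>z)"

definition bibo_stable ::
    "('nx::finite, 'nu::finite, 'nw::finite, 'nd::finite, real^'nx) stage_fun \<Rightarrow>
     ('nx, 'nu, 'nq::finite, 'nr::finite) policy \<Rightarrow> ('nq \<Rightarrow> nat) \<Rightarrow> real^'nx \<Rightarrow>
     (('nw, 'N::{finite,linorder}) wseq \<times> (real^'nd)) set \<Rightarrow> real^'nq \<Rightarrow> real^'nr \<Rightarrow> bool" where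
  "bibo_stable f \<pi> blk xhat S q r \<longleftrightarrow>
     (\<forall>\<sigma>\<^sub>w>0. \<exists>\<sigma>\<^sub>z>0. bibo_bound f \<pi> blk xhat S q r \<sigma>\<^sub>w \<sigma>\<^sub>z)"

text \<open>The amount by which the constraint \<open>v \<le> 0\<close> is violated, componentwise.\<close>

definition violation :: "real^'ng::finite \<Rightarrow> real^'ng" where
  "violation v = (\<chi> i. max 0 (v $ i))"

end

theory Submission
  imports Defs
begin

text \<open>Between the two scenarios the argument of \<open>g k\<close> changes in its trajectory,
  disturbance and parameter parts. Similarity keeps the last two changes small
  (\<open>norm_at_time_diff_le\<close> passes from the whole sequence to time \<open>k\<close>). The
  trajectory points are not shown to be close: by BIBO stability and
  \<open>norm_trajectory_point_le\<close> both lie in the ball of radius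
  \<open>\<sigma>\<^sub>z\<close> about 0, so their distance is at most its diameter, which gives
  \<open>4 * \<sigma>\<^sub>z\<^sup>2\<close>. Squared Euclidean norms of the parts add up, and the
  Lipschitz constant carries the sum over to the values of \<open>g k\<close>. Since the constraint
  holds in the first scenario, its violation in the second is at most the difference of these values
  (\<open>norm_violation_le\<close>).\<close>

lemma norm_trajectory_point_le:
  assumes "k < N"
  shows "norm (fst z k, snd z k) \<le> traj_norm N z"
proof -
  have "(norm (fst z k))\<^sup>2 \<le> (\<Sum>k\<le>N. (norm (fst z k))\<^sup>2)"
    and "(norm (snd z k))\<^sup>2 \<le> (\<Sum>k<N. (norm (snd z k))\<^sup>2)"
    using assms by (auto intro!: member_le_sum)
  then show ?thesis
    by (simp add: norm_Pair traj_norm_def)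
qed

text \<open>In a component where \<open>b\<close> is positive, \<open>a\<close> is at most 0, so
  going from \<open>a\<close> to \<open>b\<close> covers at least the whole excess of
  \<open>b\<close> over 0; in the other components the violation is 0.\<close>

lemma norm_violation_le:
  assumes "a \<le> 0"
  shows "norm (violation b) \<le> norm (a - b)"
proof (rule norm_le_componentwise_cart)
  fix i
  have "a $ i \<le> 0"
    using assms by (simp add: less_eq_vec_def)
  then show "norm (violation b $ i) \<le> norm ((a - b) $ i)"
    by (simp add: violation_def)
qed

text \<open>For a given \<open>k\<close>, \<open>at_time\<close> reads the same coordinate of both
  sequences, and a coordinate is bounded by the Euclidean norm.\<close>

lemma norm_at_time_diff_le: "norm (at_time v k - at_time w k) \<le> norm (v - w)"
  unfolding at_time_def vector_minus_component[symmetric] by (rule Finite_Cartesian_Product.norm_nth_le)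

theorem theorem3p3:
  fixes W :: "(real^'nw::finite) set" and D :: "(real^'nd::finite) set"
    and f :: "('nx::finite, 'nu::finite, 'nw, 'nd, real^'nx) stage_fun"
    and \<pi> :: "('nx, 'nu, 'nq::finite, 'nr::finite) policy"
    and blk :: "'nq \<Rightarrow> nat" and xhat :: "real^'nx"
    and Jf :: "(real^'nx) \<times> ('nw, 'N::{finite,linorder}) wseq \<times> (real^'nd) \<Rightarrow> real"
    and ell :: "('nx, 'nu, 'nw, 'nd, real) stage_fun"
    and g :: "('nx, 'nu, 'nw, 'nd, real^'ng::finite) stage_fun"
    and w1 w2 :: "('nw, 'N) wseq" and d1 d2 :: "real^'nd"
    and q :: "real^'nq" and r :: "real^'nr"
    and \<gamma> \<epsilon>\<^sub>w \<epsilon>\<^sub>d \<sigma>\<^sub>w \<sigma>\<^sub>z :: real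
    and x1 x2 :: "nat \<Rightarrow> real^'nx" and u1 u2 :: "nat \<Rightarrow> real^'nu"
  assumes W: "compact W" "W \<noteq> {}" and D: "compact D" "D \<noteq> {}"
    and blk: "\<And>j. blk j < CARD('N)"
    and f_C1: "\<And>k. k < CARD('N) \<Longrightarrow> continuously_differentiable (f k)"
    and Jf_C1: "continuously_differentiable Jf"
    and l_C1: "\<And>k. k < CARD('N) \<Longrightarrow> continuously_differentiable (ell k)"
    and g_C1: "\<And>k. k < CARD('N) \<Longrightarrow> continuously_differentiable (g k)"
    and traj_bounded: "\<And>q r w d x u.
          \<lbrakk>(w :: ('nw, 'N) wseq, d) \<in> scenarios W D; (x, u) = trajectory f \<pi> blk xhat q r w d\<rbrakk>
          \<Longrightarrow> bounded (x ` {..CARD('N)}) \<and> bounded (u ` {..<CARD('N)})"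
    and scen1: "(w1, d1) \<in> scenarios W D" and scen2: "(w2, d2) \<in> scenarios W D"
    and eps: "\<epsilon>\<^sub>w \<ge> 0" "\<epsilon>\<^sub>d \<ge> 0"
    and sim: "similar (1 / real CARD('N) * \<epsilon>\<^sub>w) \<epsilon>\<^sub>d (w1, d1) (w2, d2)"
    and sigma_w: "\<sigma>\<^sub>w > 0" "norm (w1, d1) \<le> \<sigma>\<^sub>w" "norm (w2, d2) \<le> \<sigma>\<^sub>w"
    and sol: "robust_ocp_solution f \<pi> blk xhat Jf ell g {(w1, d1)} q r \<gamma>"
    and z1: "(x1, u1) = trajectory f \<pi> blk xhat q r w1 d1"
    and z2: "(x2, u2) = trajectory f \<pi> blk xhat q r w2 d2"
    and bibo: "bibo_stable f \<pi> blk xhat (scenarios W D :: (('nw, 'N) wseq \<times> (real^'nd)) set) q r"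
    and sigma_z: "\<sigma>\<^sub>z > 0"
      "bibo_bound f \<pi> blk xhat (scenarios W D :: (('nw, 'N) wseq \<times> (real^'nd)) set) q r \<sigma>\<^sub>w \<sigma>\<^sub>z"
  shows "\<forall>k<CARD('N). \<forall>L S.
     (x1 k, u1 k, at_time w1 k, d1) \<in> S \<and> (x2 k, u2 k, at_time w2 k, d2) \<in> S \<and>
     L-lipschitz_on S (g k) \<longrightarrow>
       (norm (violation (g k (x2 k, u2 k, at_time w2 k, d2))))\<^sup>2
         \<le> L\<^sup>2 * (\<epsilon>\<^sub>w + \<epsilon>\<^sub>d + 4 * \<sigma>\<^sub>z\<^sup>2) \<and>
       (norm (g k (x1 k, u1 k, at_time w1 k, d1) - g k (x2 k, u2 k, at_time w2 k, d2)))\<^sup>2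
         \<le> L\<^sup>2 * (\<epsilon>\<^sub>w + \<epsilon>\<^sub>d + 4 * \<sigma>\<^sub>z\<^sup>2)"
proof (intro allI impI, elim conjE)
  fix k L S
  let ?p1 = "(x1 k, u1 k, at_time w1 k, d1)" and ?p2 = "(x2 k, u2 k, at_time w2 k, d2)"
  assume k: "k < CARD('N)" and S: "?p1 \<in> S" "?p2 \<in> S" and lip: "L-lipschitz_on S (g k)"
  have "norm (x1 k, u1 k) \<le> \<sigma>\<^sub>z"
  proof -
    have "traj_norm CARD('N) (x1, u1) \<le> \<sigma>\<^sub>z"
      using sigma_z(2) scen1 sigma_w(2) unfolding z1 bibo_bound_def by fast
    with norm_trajectory_point_le[OF k, of "(x1, u1)"] show ?thesis
      by simp
  qed
  moreover have "norm (x2 k, u2 k) \<le> \<sigma>\<^sub>z"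
  proof -
    have "traj_norm CARD('N) (x2, u2) \<le> \<sigma>\<^sub>z"
      using sigma_z(2) scen2 sigma_w(3) unfolding z2 bibo_bound_def by fast
    with norm_trajectory_point_le[OF k, of "(x2, u2)"] show ?thesis
      by simp
  qed
  \<comment> \<open>The triangle inequality through the origin: the factor 2 becomes 4 on
    squaring.\<close>
  ultimately have "norm ((x1 k, u1 k) - (x2 k, u2 k)) \<le> 2 * \<sigma>\<^sub>z"
    using norm_triangle_ineq4[of "(x1 k, u1 k)" "(x2 k, u2 k)"] by linarith
  from power_mono[OF this norm_ge_zero, of 2]
  have z: "(norm (x1 k - x2 k))\<^sup>2 + (norm (u1 k - u2 k))\<^sup>2 \<le> 4 * \<sigma>\<^sub>z\<^sup>2"
    by (simp add: norm_Pair power_mult_distrib)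
  \<comment> \<open>The factor \<open>1 / real CARD('N)\<close> stands on both sides of the
    similarity condition and cancels, so the horizon does not enter the bound.\<close>
  have "(norm (w1 - w2))\<^sup>2 \<le> \<epsilon>\<^sub>w" and d: "(norm (d1 - d2))\<^sup>2 \<le> \<epsilon>\<^sub>d"
    using sim by (simp_all add: similar_def divide_le_cancel)
  with power_mono[OF norm_at_time_diff_le[of w1 k w2] norm_ge_zero, of 2]
  have w: "(norm (at_time w1 k - at_time w2 k))\<^sup>2 \<le> \<epsilon>\<^sub>w"
    by linarith
  \<comment> \<open>The norm on nested pairs is Euclidean, so the squared distance is exactly the
    sum of the four squared distances.\<close>
  have p: "(norm (?p1 - ?p2))\<^sup>2 \<le> \<epsilon>\<^sub>w + \<epsilon>\<^sub>d + 4 * \<sigma>\<^sub>z\<^sup>2"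
    using z w d by (simp add: norm_Pair)
  have "norm (g k ?p1 - g k ?p2) \<le> L * norm (?p1 - ?p2)"
    using lipschitz_onD[OF lip S] by (simp only: dist_norm)
  from power_mono[OF this norm_ge_zero, of 2]
  have "(norm (g k ?p1 - g k ?p2))\<^sup>2 \<le> L\<^sup>2 * (norm (?p1 - ?p2))\<^sup>2"
    by (simp only: power_mult_distrib)
  also have "\<dots> \<le> L\<^sup>2 * (\<epsilon>\<^sub>w + \<epsilon>\<^sub>d + 4 * \<sigma>\<^sub>z\<^sup>2)"
    using p by (intro mult_left_mono) simp_all
  finally have diff: "(norm (g k ?p1 - g k ?p2))\<^sup>2 \<le> L\<^sup>2 * (\<epsilon>\<^sub>w + \<epsilon>\<^sub>d + 4 * \<sigma>\<^sub>z\<^sup>2)" .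
  \<comment> \<open>Feasibility of the solution for \<open>(w1, d1)\<close>, the one scenario in its
    problem, is what makes the difference bound a violation bound.\<close>
  have "g k ?p1 \<le> 0"
    using sol k z1 by (auto simp: robust_ocp_solution_def feasible_def)
  from power_mono[OF norm_violation_le[OF this, of "g k ?p2"] norm_ge_zero, of 2] diff
  have "(norm (violation (g k ?p2)))\<^sup>2 \<le> L\<^sup>2 * (\<epsilon>\<^sub>w + \<epsilon>\<^sub>d + 4 * \<sigma>\<^sub>z\<^sup>2)"
    by linarith
  with diff show "(norm (violation (g k ?p2)))\<^sup>2 \<le> L\<^sup>2 * (\<epsilon>\<^sub>w + \<epsilon>\<^sub>d + 4 * \<sigma>\<^sub>z\<^sup>2) \<and>
      (norm (g k ?p1 - g k ?p2))\<^sup>2 \<le> L\<^sup>2 * (\<epsilon>\<^sub>w + \<epsilon>\<^sub>d + 4 * \<sigma>\<^sub>z\<^sup>2)"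
    by (rule conjI[rotated])
qed

end
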